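(* Let $A=(a_{ij})\in\mathbb{Z}^{d\times d}$ be a nonsingular matrix in Hermite normal form, and let $\mathcal{P}(A)\subset\mathbb{R}^d$ be the $d$-dimensional integral simplex whose vertices are the row vectors of $A$ together with the origin. For each $(i_1,\ldots,i_d)\in\mathbb{Z}^d$ with $1\le i_j\le a_{jj}$ for $j=1,\dots,d$, define recursively $$\lambda_d^{i_d}=\frac{i_d}{a_{dd}},\qquad \lambda_k^{i_k,i_{k+1},\ldots,i_d}=\frac{1}{a_{kk}}\Big(i_k-\Big\{\sum_{h=k+1}^{d}a_{hk}\,\lambda_h^{i_h,i_{h+1},\ldots,i_d}\Big\}\Big)\quad (1\le k<d),$$ and $$s_{i_1\cdots i_d}=\Big\lfloor\sum_{k=1}^{d}\lambda_k^{i_k,i_{k+1},\ldots,i_d}\Big\rfloor+1 .$$ Then the generating function for the numbers of interior lattice points $i^*(\mathcal{P}(A),n)=|n(\mathcal{P}(A)-\partial\mathcal{P}(A))\cap\mathbb{Z}^d|$ is $$\sum_{n=1}^{\infty}i^*(\mathcal{P}(A),n)\,t^n=(1-t)^{-(d+1)}\sum_{\substack{(i_1,\ldots,i_d)\\ 1\le i_j\le a_{jj}}}t^{\,s_{i_1\cdots i_d}},$$ and the $\delta$-polynomial of $\mathcal{P}(A)$ is $$\delta_{\mathcal{P}(A)}(t)=\sum_{\substack{(i_1,\ldots,i_d)\\ 1\le i_j\le a_{jj}}}t^{\,d+1-s_{i_1\cdots i_d}} .$$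
   Context: Here $\lfloor r\rfloor$ is the largest integer not larger than $r$ and $\{r\}=r-\lfloor r\rfloor$ is the fractional part of a rational number $r$. A nonsingular matrix $A=(a_{ij})\in\mathbb{Z}^{d\times d}$ is in Hermite normal form if it is lower triangular with nonnegative integer entries and $0\le a_{ij}<a_{ii}$ for all $1\le j<i$. $\partial\mathcal{P}$ denotes the boundary of $\mathcal{P}$, and $nX=\{nx:x\in X\}$. For an integral polytope $\mathcal{P}\subset\mathbb{R}^d$ of dimension $d$ (all vertices in $\mathbb{Z}^d$), the $\delta$-polynomial $\delta_{\mathcal{P}}(t)=\delta_0+\delta_1t+\cdots+\delta_dt^d$ is defined by $$\delta_{\mathcal{P}}(t)=(1-t)^{d+1}\Big(1+\sum_{n=1}^{\infty}|n\mathcal{P}\cap\mathbb{Z}^d|\,t^n\Big).$$ *)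

theory Defs
  imports "HOL-Analysis.Analysis" "HOL-Computational_Algebra.Computational_Algebra"
begin

(* The index set {1,...,d} is rendered by an arbitrary finite linearly ordered type 'n with
   d = CARD('n); it is order isomorphic to {1,...,d}, and A $ i $ j is the entry a_ij. *)

definition hermite_normal_form ::
  "int ^ ('n::{finite,linorder}) ^ ('n::{finite,linorder}) \<Rightarrow> bool" where
  "hermite_normal_form A \<longleftrightarrow>
     (\<forall>i j. i < j \<longrightarrow> A $ i $ j = 0) \<and>
     (\<forall>i j. 0 \<le> A $ i $ j) \<and>
     (\<forall>i j. j < i \<longrightarrow> A $ i $ j < A $ i $ i)"

definition row_simplex :: "int ^ ('n::finite) ^ ('n::finite) \<Rightarrow> (real ^ 'n) set" where
  "row_simplex A = convex hull (insert 0 (range (\<lambda>i. \<chi> j. real_of_int (A $ i $ j))))"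

definition lattice_points :: "(real ^ 'n) set" where
  "lattice_points = {x. \<forall>j. x $ j \<in> \<int>}"

definition lattice_count :: "(real ^ 'n) set \<Rightarrow> nat \<Rightarrow> nat" where
  "lattice_count P n = card ((\<lambda>x. real n *\<^sub>R x) ` P \<inter> lattice_points)"

(* For P of full dimension d, the only case in which this is used, the topological frontier in
   R^d is the boundary of P. *)
definition interior_lattice_count :: "(real ^ 'n) set \<Rightarrow> nat \<Rightarrow> nat" where
  "interior_lattice_count P n =
     card ((\<lambda>x. real n *\<^sub>R x) ` (P - frontier P) \<inter> lattice_points)"

(* The defining expression of the delta-polynomial of a full-dimensional integral polytope.  It is
   a formal power series by construction, with coefficients in the field rat so that inverse
   powers of 1 - t are available as well. *)
definition delta_series :: "(real ^ 'n) set \<Rightarrow> rat fps" where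
  "delta_series P = (1 - fps_X) ^ (CARD('n) + 1) *
     (1 + Abs_fps (\<lambda>n. if n = 0 then 0 else of_nat (lattice_count P n)))"

definition index_box :: "int ^ ('n::finite) ^ ('n::finite) \<Rightarrow> (int ^ 'n) set" where
  "index_box A = {i. \<forall>j. 1 \<le> i $ j \<and> i $ j \<le> A $ j $ j}"

(* For the largest index the sum is empty and frac 0 = 0, so the same equation also covers the
   initial value i_d / a_dd of the recursion. *)
function lam ::
  "int ^ ('n::{finite,linorder}) ^ ('n::{finite,linorder}) \<Rightarrow> int ^ ('n::{finite,linorder}) \<Rightarrow>
    'n \<Rightarrow> rat" where
  "lam A i k = 1 / of_int (A $ k $ k) *
     (of_int (i $ k) - frac (\<Sum>h\<in>{k<..}. of_int (A $ h $ k) * lam A i h))"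
  by pat_completeness auto
termination
proof (relation "Wellfounded.measure (\<lambda>(A, i, k). card {k<..})")
  fix A :: "int ^ ('n::{finite,linorder}) ^ ('n::{finite,linorder})"
    and i :: "int ^ ('n::{finite,linorder})" and h k :: 'n
  assume "h \<in> {k<..}"
  then have "{h<..} \<subset> {k<..}" by fastforce
  moreover have "finite {k<..}" by (rule finite)
  ultimately show "((A, i, h), (A, i, k)) \<in> Wellfounded.measure (\<lambda>(A, i, k). card {k<..})"
    by (simp add: psubset_card_mono)
qed simp

declare lam.simps [simp del]

definition s_exp ::
  "int ^ ('n::{finite,linorder}) ^ ('n::{finite,linorder}) \<Rightarrow>
    int ^ ('n::{finite,linorder}) \<Rightarrow> int" where
  "s_exp A i = \<lfloor>\<Sum>k\<in>UNIV. lam A i k\<rfloor> + 1"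

lemma lam_last:
  assumes "\<And>h. h \<le> k"
  shows "lam A i k = of_int (i $ k) / of_int (A $ k $ k)"
proof -
  have "{k<..} = {}" using assms by (auto simp: leD)
  then show ?thesis by (simp add: lam.simps[of A i k])
qed

lemma finite_index_box: "finite (index_box A)"
proof -
  have "index_box A \<subseteq> vec_lambda ` (\<Pi>\<^sub>E j\<in>UNIV. {1..A $ j $ j})"
  proof
    fix i assume "i \<in> index_box A"
    then have "vec_nth i \<in> (\<Pi>\<^sub>E j\<in>UNIV. {1..A $ j $ j})"
      by (auto simp: index_box_def PiE_def Pi_def)
    then show "i \<in> vec_lambda ` (\<Pi>\<^sub>E j\<in>UNIV. {1..A $ j $ j})"
      by (metis imageI vec_nth_inverse)
  qed
  then show ?thesis
    by (rule finite_subset) (intro finite_imageI finite_PiE, auto)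
qed

lemma lam_bounds:
  assumes "i \<in> index_box A"
  shows "0 < lam A i k" "lam A i k \<le> 1"
proof -
  define r where "r = frac (\<Sum>h\<in>{k<..}. of_int (A $ h $ k) * lam A i h)"
  have r: "0 \<le> r" "r < 1" by (simp_all add: r_def frac_lt_1)
  have i: "1 \<le> i $ k" "i $ k \<le> A $ k $ k" using assms by (auto simp: index_box_def)
  have i': "(1::rat) \<le> of_int (i $ k)" "of_int (i $ k) \<le> (of_int (A $ k $ k) :: rat)"
    using i by simp_all
  have eq: "lam A i k = (of_int (i $ k) - r) / of_int (A $ k $ k)"
    by (simp add: lam.simps[of A i k] r_def)
  show "0 < lam A i k" "lam A i k \<le> 1"
    unfolding eq using r i' by (auto intro!: divide_pos_pos simp: divide_le_eq_1)
qed

(* Hence the conversions nat (s_exp A i) and nat (d + 1 - s_exp A i) never truncate, and the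
   exponents of the delta-polynomial lie between 0 and d. *)
lemma s_exp_bounds:
  fixes A :: "int ^ ('n::{finite,linorder}) ^ ('n::{finite,linorder})"
  assumes "i \<in> index_box A"
  shows "1 \<le> s_exp A i" "s_exp A i \<le> int CARD('n) + 1"
proof -
  have "0 \<le> (\<Sum>k\<in>UNIV. lam A i k)"
    using lam_bounds(1)[OF assms] by (intro sum_nonneg) (simp add: less_imp_le)
  then show "1 \<le> s_exp A i" by (simp add: s_exp_def)
  have "(\<Sum>k\<in>UNIV. lam A i k) \<le> (\<Sum>k\<in>(UNIV::'n set). 1)"
    using lam_bounds(2)[OF assms] by (intro sum_mono)
  then have "(\<Sum>k\<in>UNIV. lam A i k) \<le> of_int (int CARD('n))" by simp
  then have "\<lfloor>\<Sum>k\<in>UNIV. lam A i k\<rfloor> \<le> int CARD('n)"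
    by (metis floor_mono floor_of_int)
  then show "s_exp A i \<le> int CARD('n) + 1" by (simp add: s_exp_def)
qed

lemma row_simplex_simplex:
  fixes A :: "int ^ ('n::finite) ^ ('n::finite)"
  assumes "det A \<noteq> 0"
  shows "int CARD('n) simplex row_simplex A"
proof -
  define M :: "real ^ 'n ^ 'n" where "M = (\<chi> i j. real_of_int (A $ i $ j))"
  have "det M = real_of_int (det A)"
    by (simp add: det_def M_def)
  then have dM: "det M \<noteq> 0" using assms by simp
  define R where "R = range (\<lambda>i. row i M)"
  have Reqn: "R = range (\<lambda>i. \<chi> j. real_of_int (A $ i $ j))"
    by (simp add: R_def M_def row_def)
  have inj: "inj (\<lambda>i. row i M)"
    using dM det_identical_rows[of _ _ M] by (auto simp: inj_def)
  have ind: "independent R"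
    using dM det_dependent_rows[of M]
    by (auto simp: R_def rows_def full_SetCompr_eq dependent_vec_eq)
  have z: "0 \<notin> R" using ind dependent_zero by blast
  have aff: "\<not> affine_dependent (insert 0 R)"
    using ind affine_dependent_iff_dependent[OF z] by simp
  have "card R = CARD('n)" unfolding R_def by (rule card_image[OF inj])
  moreover have "finite R" by (simp add: R_def)
  ultimately have "int (card (insert 0 R)) = int CARD('n) + 1" using z by simp
  with aff show ?thesis unfolding simplex_def row_simplex_def Reqn[symmetric] by blast
qed

end

theory Submission
  imports Defs
begin

text \<open>
  Write a point as \<open>\<Sum>k. c k * (row k of A)\<close>.  It lies in the \<open>n\<close>-th dilate of the simplex iff
  all \<open>c k\<close> are nonnegative and \<open>\<Sum>k. c k \<le> n\<close>; it comes from an interior point of the simplex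
  (for \<open>n > 0\<close>) iff both kinds of inequalities are strict.  Being a lattice point is a condition
  on \<open>c\<close> that is invariant under adding integer vectors.  So every admissible \<open>c\<close> can be reduced
  modulo 1 in each coordinate: a positive \<open>c\<close> is uniquely a representative in the half-open cube
  \<open>(0,1]^d\<close> plus a vector \<open>m\<close> of natural numbers, a nonnegative \<open>c\<close> is uniquely a representative in
  \<open>[0,1)^d\<close> plus such an \<open>m\<close> (\<open>bij_betw_tiling\<close>).

  The recursion for \<open>\<lambda>\<close> solves the integrality conditions on the representative from the last
  coordinate downwards.  As \<open>A\<close> is lower triangular, the condition for column \<open>k\<close> says that
  \<open>a_kk * c k + \<Sum>h>k. a_hk * c h\<close> is an integer; once the \<open>c h\<close> with \<open>h > k\<close> are known, its
  solutions with \<open>0 < c k \<le> 1\<close> are exactly the numbers \<open>(i_k - frac (\<Sum>h>k. a_hk * c h)) / a_kk\<close>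
  with \<open>1 \<le> i_k \<le> a_kk\<close>.  Hence \<open>i \<mapsto> \<lambda>\<close> enumerates the representatives in \<open>(0,1]^d\<close>
  (\<open>bij_betw_lam_vec\<close>), and \<open>i \<mapsto> 1 - \<lambda>\<close> those in \<open>[0,1)^d\<close>, since negating \<open>c\<close> preserves
  integrality (\<open>bij_betw_one_minus_lam_vec\<close>).

  It remains to count the vectors \<open>m\<close> for each \<open>i\<close>.  The sum of all \<open>m k\<close> is an integer, so
  \<open>\<Sum>\<lambda> + \<Sum>m < n\<close> is equivalent to \<open>\<Sum>m + s \<le> n\<close> with \<open>s = \<lfloor>\<Sum>\<lambda>\<rfloor> + 1\<close>, and
  \<open>d - \<Sum>\<lambda> + \<Sum>m \<le> n\<close> to \<open>\<Sum>m + (d + 1 - s) \<le> n\<close>.  The number of \<open>m\<close> with \<open>\<Sum>m + e \<le> n\<close> is the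
  coefficient of \<open>t^n\<close> in \<open>t^e / (1-t)^(d+1)\<close>, the extra factor \<open>1 / (1-t)\<close> accounting for the slack
  variable \<open>n - e - \<Sum>m\<close>.  Summation over \<open>i\<close> gives both generating functions.
\<close>

(* Both power series coefficients and vector components are written with an infix dollar;
   below it stands for vector components only. *)
no_notation fps_nth (infixl "$" 75)

section \<open>Lattice points of dilated standard simplices\<close>

text \<open>
  Prepending the slack \<open>N - \<Sum>m\<close> turns an inequality in \<open>d\<close> unknowns into an equation in \<open>d + 1\<close>
  unknowns; the lists in \<open>natpermute\<close> are the solutions counted by the coefficients of a power of
  a power series.
\<close>
lemma bij_betw_bounded_sum_natpermute:
  "\<exists>g. bij_betw g {m :: 'n::finite \<Rightarrow> nat. sum m UNIV \<le> N} (natpermute N (CARD('n) + 1))"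
proof -
  let ?d = "CARD('n)"
  obtain h where h: "bij_betw h {0..<?d} (UNIV :: 'n set)"
    using ex_bij_betw_nat_finite[OF finite_class.finite_UNIV] by blast
  define k where "k = inv_into {0..<?d} h"
  have kh: "k (h j) = j" if "j < ?d" for j
    using bij_betw_inv_into_left[OF h, of j] that by (simp add: k_def)
  have hk: "h (k x) = x" for x
    using bij_betw_inv_into_right[OF h, of x] by (simp add: k_def)
  have k_less: "k x < ?d" for x
    using bij_betw_inv_into[OF h] by (auto simp: k_def bij_betw_def)
  have sum_h: "(\<Sum>j = 0..<?d. m (h j)) = sum m UNIV" for m :: "'n \<Rightarrow> nat"
    by (rule sum.reindex_bij_betw[OF h])
  have sum_k: "(\<Sum>x\<in>UNIV. l ! k x) = sum_list l" if "length l = ?d" for l :: "nat list"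
    using sum_h[of "\<lambda>x. l ! k x"] kh that by (simp add: sum_list_sum_nth)
  have "bij_betw (\<lambda>m. (N - sum m UNIV) # map (\<lambda>j. m (h j)) [0..<?d])
          {m. sum m UNIV \<le> N} (natpermute N (?d + 1))"
  proof (rule bij_betw_byWitness[where f' = "\<lambda>l x. tl l ! k x"])
    show "\<forall>m\<in>{m. sum m UNIV \<le> N}.
        (\<lambda>x. tl ((N - sum m UNIV) # map (\<lambda>j. m (h j)) [0..<?d]) ! k x) = m"
      by (auto simp: k_less hk)
    show "\<forall>l\<in>natpermute N (?d + 1).
        (N - (\<Sum>x\<in>UNIV. tl l ! k x)) # map (\<lambda>j. tl l ! k (h j)) [0..<?d] = l"
    proof
      fix l assume l: "l \<in> natpermute N (?d + 1)"
      then obtain a l' where "l = a # l'" "length l' = ?d" "a + sum_list l' = N"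
        by (cases l) (auto simp: natpermute_def)
      then show "(N - (\<Sum>x\<in>UNIV. tl l ! k x)) # map (\<lambda>j. tl l ! k (h j)) [0..<?d] = l"
        by (auto simp: sum_k kh intro!: nth_equalityI)
    qed
    show "(\<lambda>m. (N - sum m UNIV) # map (\<lambda>j. m (h j)) [0..<?d]) ` {m. sum m UNIV \<le> N}
        \<subseteq> natpermute N (?d + 1)"
      by (auto simp: natpermute_def interv_sum_list_conv_sum_set_nat sum_h)
    show "(\<lambda>l x. tl l ! k x) ` natpermute N (?d + 1) \<subseteq> {m. sum m UNIV \<le> N}"
    proof safe
      fix l assume "l \<in> natpermute N (?d + 1)"
      then obtain a l' where "l = a # l'" "length l' = ?d" "a + sum_list l' = N"
        by (cases l) (auto simp: natpermute_def)
      then show "(\<Sum>x\<in>UNIV. tl l ! k x) \<le> N" by (auto simp: sum_k)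
    qed
  qed
  then show ?thesis by blast
qed

lemma finite_bounded_sum: "finite {m :: 'n::finite \<Rightarrow> nat. sum m UNIV + e \<le> n}"
proof -
  have "finite {m :: 'n \<Rightarrow> nat. sum m UNIV \<le> n}"
    using bij_betw_bounded_sum_natpermute bij_betw_finite natpermute_finite by blast
  then show ?thesis by (rule rev_finite_subset) auto
qed

lemma card_bounded_sum:
  "of_nat (card {m :: 'n::finite \<Rightarrow> nat. sum m UNIV \<le> N}) =
     fps_nth (inverse ((1 - fps_X) ^ (CARD('n) + 1)) :: rat fps) N"
proof -
  obtain g where "bij_betw g {m :: 'n \<Rightarrow> nat. sum m UNIV \<le> N} (natpermute N (CARD('n) + 1))"
    using bij_betw_bounded_sum_natpermute by blast
  then have "card {m :: 'n \<Rightarrow> nat. sum m UNIV \<le> N} = card (natpermute N (CARD('n) + 1))"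
    by (rule bij_betw_same_card)
  then show ?thesis
    by (simp add: fps_inverse_power fps_inverse_one_minus_fps_X fps_power_nth del: power_Suc)
qed

lemma card_shifted_bounded_sum:
  "of_nat (card {m :: 'n::finite \<Rightarrow> nat. sum m UNIV + e \<le> n}) =
     fps_nth (inverse ((1 - fps_X) ^ (CARD('n) + 1)) * fps_X ^ e :: rat fps) n"
proof (cases "n < e")
  case True
  then show ?thesis by (simp add: fps_X_power_mult_right_nth)
next
  case False
  then have "{m :: 'n \<Rightarrow> nat. sum m UNIV + e \<le> n} = {m. sum m UNIV \<le> n - e}" by auto
  with False show ?thesis
    by (simp add: fps_X_power_mult_right_nth card_bounded_sum del: power_Suc)
qed

section \<open>Tiling an orthant by translates of a half-open parallelepiped\<close>

text \<open>
  The two fundamental domains of the reals modulo the integers that are needed: the first for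
  interior points, the second for all points of the simplex.
\<close>
definition half_open_interval :: "real set \<Rightarrow> bool" where
  "half_open_interval H \<longleftrightarrow> H = {0<..1} \<or> H = {0..<1}"

lemma half_open_unique:
  assumes "half_open_interval H" "s \<in> H" "t \<in> H" "s + real m = t + real n"
  shows "m = n"
  using assms unfolding half_open_interval_def by auto

text \<open>
  \<open>L\<close> is any set of vectors that is invariant under integer translations, \<open>b\<close> enumerates its part in
  the half-open cube \<open>H^d\<close>.  Translating \<open>H\<close> by natural numbers gives \<open>T\<close>, and uniqueness of the
  decomposition holds coordinate by coordinate because \<open>H\<close> has one element in each residue class.
\<close>
lemma bij_betw_tiling:
  fixes b :: "'i \<Rightarrow> real ^ 'n::finite"
  assumes b: "bij_betw b I {c \<in> L. \<forall>k. c $ k \<in> H}"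
    and H: "half_open_interval H"
    and L: "\<And>c z. (\<And>k. z $ k \<in> \<int>) \<Longrightarrow> c + z \<in> L \<longleftrightarrow> c \<in> L"
    and T: "T = {t + real m |t m. t \<in> H}"
  shows "bij_betw (\<lambda>(i, m). b i + (\<chi> k. real (m k))) (I \<times> UNIV) {c \<in> L. \<forall>k. c $ k \<in> T}"
proof -
  have bH: "b i \<in> L" "b i $ k \<in> H" if "i \<in> I" for i k
    using bij_betwE[OF b] that by auto
  show ?thesis
    unfolding bij_betw_def
  proof
    show "inj_on (\<lambda>(i, m). b i + (\<chi> k. real (m k))) (I \<times> UNIV)"
    proof (rule inj_onI, clarify)
      fix i j and m n :: "'n \<Rightarrow> nat"
      assume ij: "i \<in> I" "j \<in> I" and eq: "b i + (\<chi> k. real (m k)) = b j + (\<chi> k. real (n k))"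
      have eq': "b i $ k + real (m k) = b j $ k + real (n k)" for k
        using arg_cong[OF eq, of "\<lambda>v. v $ k"] by simp
      have "m = n" using half_open_unique[OF H bH(2)[OF ij(1)] bH(2)[OF ij(2)] eq'] by blast
      with eq have "b i = b j" by simp
      with ij b have "i = j" by (auto simp: bij_betw_def dest: inj_onD)
      with \<open>m = n\<close> show "i = j \<and> m = n" by simp
    qed
    show "(\<lambda>(i, m). b i + (\<chi> k. real (m k))) ` (I \<times> UNIV) = {c \<in> L. \<forall>k. c $ k \<in> T}"
    proof (intro equalityI subsetI)
      fix c assume "c \<in> (\<lambda>(i, m). b i + (\<chi> k. real (m k))) ` (I \<times> UNIV)"
      then show "c \<in> {c \<in> L. \<forall>k. c $ k \<in> T}"
        using bH by (fastforce simp: L T)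
    next
      fix c assume c: "c \<in> {c \<in> L. \<forall>k. c $ k \<in> T}"
      then have "\<forall>k. \<exists>p. c $ k = fst p + real (snd p) \<and> fst p \<in> H" by (auto simp: T)
      then obtain p where p: "\<And>k. c $ k = fst (p k) + real (snd (p k))" "\<And>k. fst (p k) \<in> H"
        by metis
      define r where "r = (\<chi> k. fst (p k))"
      define m where "m k = snd (p k)" for k
      have cr: "c = r + (\<chi> k. real (m k))" by (simp add: vec_eq_iff r_def m_def p)
      with c have "r \<in> L" by (auto simp: L)
      then have "r \<in> {c \<in> L. \<forall>k. c $ k \<in> H}" using p(2) by (simp add: r_def)
      then obtain i where "i \<in> I" "r = b i"
        using bij_betw_imp_surj_on[OF b] by blast
      then show "c \<in> (\<lambda>(i, m). b i + (\<chi> k. real (m k))) ` (I \<times> UNIV)"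
        using cr by (intro image_eqI[where x = "(i, m)"]) auto
    qed
  qed
qed

text \<open>
  If a condition \<open>P\<close> on a tiled set only bounds the sum of the translation vector, with an offset
  \<open>e i\<close> depending on the representative, then each representative contributes a shifted copy
  of the generating function of the standard simplex.
\<close>
lemma card_tiling:
  fixes b :: "'i \<Rightarrow> real ^ 'n::finite"
  assumes tiling: "bij_betw (\<lambda>(i, m). b i + (\<chi> k. real (m k))) (I \<times> UNIV) S"
    and "finite I"
    and P: "\<And>i m. i \<in> I \<Longrightarrow> P (b i + (\<chi> k. real (m k))) \<longleftrightarrow> sum m UNIV + e i \<le> n"
  shows "of_nat (card {c \<in> S. P c}) =
    fps_nth (inverse ((1 - fps_X) ^ (CARD('n) + 1)) * (\<Sum>i\<in>I. fps_X ^ e i) :: rat fps) n"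
proof -
  let ?g = "\<lambda>(i, m). b i + (\<chi> k. real (m k))"
  let ?M = "\<lambda>i. {m :: 'n \<Rightarrow> nat. sum m UNIV + e i \<le> n}"
  have "{c \<in> S. P c} = ?g ` Sigma I ?M"
  proof (intro equalityI subsetI)
    fix c assume c: "c \<in> {c \<in> S. P c}"
    then obtain p where "p \<in> I \<times> UNIV" "c = ?g p"
      using bij_betw_imp_surj_on[OF tiling] by blast
    with c P show "c \<in> ?g ` Sigma I ?M"
      by (cases p) (auto intro!: image_eqI[of _ _ p])
  next
    fix c assume "c \<in> ?g ` Sigma I ?M"
    then obtain i m where im: "i \<in> I" "m \<in> ?M i" "c = ?g (i, m)" by blast
    then have "?g (i, m) \<in> S" by (intro bij_betwE[OF tiling, rule_format]) simp
    with im P show "c \<in> {c \<in> S. P c}" by auto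
  qed
  moreover have "inj_on ?g (Sigma I ?M)"
    using bij_betw_imp_inj_on[OF tiling] by (rule inj_on_subset) auto
  ultimately have "card {c \<in> S. P c} = card (Sigma I ?M)"
    by (simp only: card_image)
  also have "\<dots> = (\<Sum>i\<in>I. card (?M i))"
    using \<open>finite I\<close> finite_bounded_sum by (intro card_SigmaI) auto
  finally show ?thesis
    by (simp add: card_shifted_bounded_sum sum_distrib_left fps_sum_nth del: power_Suc)
qed

section \<open>Barycentric coordinates\<close>

definition row_combination :: "int ^ 'n ^ 'n \<Rightarrow> real ^ 'n \<Rightarrow> real ^ 'n::finite" where
  "row_combination A c = (\<chi> j. \<Sum>k\<in>UNIV. c $ k * of_int (A $ k $ j))"

definition integral_combinations :: "int ^ 'n ^ 'n \<Rightarrow> (real ^ 'n::finite) set" where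
  "integral_combinations A = {c. row_combination A c \<in> lattice_points}"

lemma linear_row_combination: "linear (row_combination A)"
  by (rule linearI)
     (auto simp: row_combination_def vec_eq_iff algebra_simps sum.distrib sum_distrib_left)

text \<open>
  \<open>row_combination A\<close> is multiplication by the transpose of \<open>A\<close>, which is invertible over the
  reals because its determinant is the nonzero integer \<open>det A\<close>.
\<close>
lemma inj_row_combination:
  assumes "det A \<noteq> 0"
  shows "inj (row_combination A)"
proof -
  define M :: "real ^ 'a ^ 'a" where "M = (\<chi> i j. real_of_int (A $ i $ j))"
  have "det M = real_of_int (det A)" by (simp add: det_def M_def)
  then have "det (transpose M) \<noteq> 0" using assms by simp
  then have "inj ((*v) (transpose M))" 
    by (simp add: inj_matrix_vector_mult invertible_det_nz)
  moreover have "row_combination A = (*v) (transpose M)"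
    by (auto simp: row_combination_def matrix_vector_mult_def transpose_def M_def fun_eq_iff
        vec_eq_iff mult.commute)
  ultimately show ?thesis by simp
qed

text \<open>
  Through the linear map \<open>row_combination A\<close> the inequalities describing the standard simplex and
  its interior carry over to \<open>row_simplex A\<close>.
\<close>
lemma row_simplex_eq_image:
  "row_simplex A = row_combination A ` (convex hull (insert 0 Basis))"
proof -
  have "row_combination A (axis i 1) = (\<chi> j. real_of_int (A $ i $ j))" for i
    by (auto simp: row_combination_def axis_def vec_eq_iff if_distrib if_distribR
        cong: if_cong)
  then have "row_combination A ` Basis = range (\<lambda>i. \<chi> j. real_of_int (A $ i $ j))"
    by (auto simp: Basis_vec_def image_iff) 
  then show ?thesis
    by (simp add: row_simplex_def convex_hull_linear_image[OF linear_row_combination]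
        linear_0[OF linear_row_combination])
qed

lemma Basis_vec_coordinates:
  fixes c :: "real ^ 'n::finite"
  shows "(\<forall>u\<in>Basis. P (c \<bullet> u)) \<longleftrightarrow> (\<forall>k. P (c $ k))"
    and "(\<Sum>u\<in>Basis. c \<bullet> u) = (\<Sum>k\<in>UNIV. c $ k)"
proof -
  have B: "Basis = range (\<lambda>k. axis k 1 :: real ^ 'n)" by (auto simp: Basis_vec_def)
  have inj: "inj (\<lambda>k. axis k 1 :: real ^ 'n)" by (auto simp: inj_def axis_eq_axis)
  show "(\<forall>u\<in>Basis. P (c \<bullet> u)) \<longleftrightarrow> (\<forall>k. P (c $ k))"
    by (simp add: B inner_axis)
  show "(\<Sum>u\<in>Basis. c \<bullet> u) = (\<Sum>k\<in>UNIV. c $ k)"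
    by (simp add: B sum.reindex[OF inj] inner_axis)
qed

lemma std_simplex_vec:
  "convex hull (insert 0 Basis) =
     {c :: real ^ 'n::finite. (\<forall>k. 0 \<le> c $ k) \<and> (\<Sum>k\<in>UNIV. c $ k) \<le> 1}"
  unfolding std_simplex Basis_vec_coordinates ..

lemma interior_std_simplex_vec:
  "interior (convex hull (insert 0 Basis)) =
     {c :: real ^ 'n::finite. (\<forall>k. 0 < c $ k) \<and> (\<Sum>k\<in>UNIV. c $ k) < 1}"
  unfolding interior_std_simplex Basis_vec_coordinates ..

lemma scaleR_row_combination: "t *\<^sub>R row_combination A c = row_combination A (t *\<^sub>R c)"
  using linear_scale[OF linear_row_combination] by metis

lemma card_dilate_row_combination:
  assumes "det A \<noteq> 0"
  shows "card ((\<lambda>x. t *\<^sub>R x) ` row_combination A ` S \<inter> lattice_points) =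
    card (integral_combinations A \<inter> (\<lambda>c. t *\<^sub>R c) ` S)"
proof -
  have "(\<lambda>x. t *\<^sub>R x) ` row_combination A ` S \<inter> lattice_points =
      row_combination A ` (integral_combinations A \<inter> (\<lambda>c. t *\<^sub>R c) ` S)"
    by (auto simp: integral_combinations_def scaleR_row_combination image_iff)
  then show ?thesis
    using inj_row_combination[OF assms] by (simp add: card_image inj_on_def)
qed

text \<open>
  For \<open>n = 0\<close> the dilate is the single point \<open>0\<close>, and the inequalities with \<open>n = 0\<close> also describe
  just this point.
\<close>
lemma lattice_count_eq:
  assumes "det A \<noteq> 0"
  shows "lattice_count (row_simplex A) n =
    card {c \<in> {c \<in> integral_combinations A. \<forall>k. c $ k \<in> {0..}}. (\<Sum>k\<in>UNIV. c $ k) \<le> real n}"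
proof -
  have "(\<lambda>c. real n *\<^sub>R c) ` (convex hull (insert 0 Basis)) =
      {c :: real ^ 'a. (\<forall>k. 0 \<le> c $ k) \<and> (\<Sum>k\<in>UNIV. c $ k) \<le> real n}" (is "?l = ?r")
  proof (intro equalityI subsetI)
    fix c assume "c \<in> ?l"
    then show "c \<in> ?r"
      by (auto simp: std_simplex_vec sum_distrib_left[symmetric] mult_left_le)
  next
    fix c assume c: "c \<in> ?r"
    show "c \<in> ?l"
    proof (cases "n = 0")
      case True
      with c have "(\<Sum>k\<in>UNIV. c $ k) = 0" by (auto intro: antisym sum_nonneg)
      with c have "c = 0" by (auto simp: vec_eq_iff sum_nonneg_eq_0_iff)
      with True show ?thesis by (intro image_eqI[of _ _ 0]) (auto simp: std_simplex_vec)
    next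
      case False
      with c show ?thesis
        by (intro image_eqI[of _ _ "(1 / real n) *\<^sub>R c"])
           (auto simp: std_simplex_vec sum_divide_distrib[symmetric])
    qed
  qed
  then show ?thesis
    unfolding lattice_count_def row_simplex_eq_image card_dilate_row_combination[OF assms]
    by (intro arg_cong[of _ _ card]) auto
qed

text \<open>
  Here \<open>n = 0\<close> has to be excluded: the dilate of the nonempty interior would be \<open>{0}\<close>, while the strict
  inequalities have no solution.
\<close>
lemma interior_lattice_count_eq:
  assumes "det A \<noteq> 0" "n > 0"
  shows "interior_lattice_count (row_simplex A) n =
    card {c \<in> {c \<in> integral_combinations A. \<forall>k. c $ k \<in> {0<..}}. (\<Sum>k\<in>UNIV. c $ k) < real n}"
proof -
  have "row_simplex A - frontier (row_simplex A) = interior (row_simplex A)"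
    using closure_subset[of "row_simplex A"] interior_subset[of "row_simplex A"]
    by (auto simp: frontier_def)
  also have "\<dots> = row_combination A ` interior (convex hull (insert 0 Basis))"
    unfolding row_simplex_eq_image
    by (rule interior_injective_linear_image[OF linear_row_combination inj_row_combination[OF assms(1)]])
  finally have int: "row_simplex A - frontier (row_simplex A) =
    row_combination A ` interior (convex hull (insert 0 Basis))" .
  have "(\<lambda>c. real n *\<^sub>R c) ` interior (convex hull (insert 0 Basis)) =
      {c :: real ^ 'a. (\<forall>k. 0 < c $ k) \<and> (\<Sum>k\<in>UNIV. c $ k) < real n}" (is "?l = ?r")
  proof (intro equalityI subsetI)
    fix c assume "c \<in> ?l"
    with assms(2) show "c \<in> ?r"
      by (auto simp: interior_std_simplex_vec sum_distrib_left[symmetric])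
  next
    fix c assume "c \<in> ?r"
    with assms(2) show "c \<in> ?l"
      by (intro image_eqI[of _ _ "(1 / real n) *\<^sub>R c"])
         (auto simp: interior_std_simplex_vec sum_divide_distrib[symmetric])
  qed
  then show ?thesis
    unfolding interior_lattice_count_def int card_dilate_row_combination[OF assms(1)]
    by (intro arg_cong[of _ _ card]) auto
qed

lemma integral_combinations_iff:
  "c \<in> integral_combinations A \<longleftrightarrow> (\<forall>j. (\<Sum>k\<in>UNIV. c $ k * of_int (A $ k $ j)) \<in> \<int>)"
  by (simp add: integral_combinations_def lattice_points_def row_combination_def)

lemma integral_combinations_add_int:
  assumes "\<And>k. z $ k \<in> \<int>"
  shows "c + z \<in> integral_combinations A \<longleftrightarrow> c \<in> integral_combinations A"
proof -
  have "(\<Sum>k\<in>UNIV. z $ k * of_int (A $ k $ j)) \<in> \<int>" for j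
    using assms by (intro Ints_sum Ints_mult) auto
  then have "(\<Sum>k\<in>UNIV. (c + z) $ k * of_int (A $ k $ j)) \<in> \<int> \<longleftrightarrow>
      (\<Sum>k\<in>UNIV. c $ k * of_int (A $ k $ j)) \<in> \<int>" for j
    by (simp add: distrib_right sum.distrib)
  then show ?thesis by (simp add: integral_combinations_iff)
qed

lemma integral_combinations_uminus:
  "- c \<in> integral_combinations A \<longleftrightarrow> c \<in> integral_combinations A"
  by (simp add: integral_combinations_iff sum_negf)

section \<open>The lattice points of the fundamental parallelepiped\<close>

text \<open>
  A zero on the diagonal would force the whole row to vanish: the entries left of it would have
  to be nonnegative and negative at the same time, so there are none, and those right of it are
  zero by triangularity.
\<close>
lemma hermite_diagonal_pos:
  fixes A :: "int ^ ('n::{finite,linorder}) ^ ('n::{finite,linorder})"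
  assumes "det A \<noteq> 0" "hermite_normal_form A"
  shows "0 < A $ k $ k"
proof (rule ccontr)
  assume "\<not> 0 < A $ k $ k"
  with assms(2) have "A $ k $ k = 0" by (metis hermite_normal_form_def order_less_le)
  with assms(2) have "A $ k $ j = 0" for j
    using less_linear[of j k] unfolding hermite_normal_form_def by (metis not_le)
  then have "row k A = 0" by (simp add: row_def vec_eq_iff)
  with assms(1) show False using det_zero_row by blast
qed

lemma of_rat_frac: "(of_rat (frac x) :: real) = frac (of_rat x)"
  by (simp add: frac_def of_rat_diff)

definition lam_vec ::
  "int ^ ('n::{finite,linorder}) ^ ('n::{finite,linorder}) \<Rightarrow> int ^ ('n::{finite,linorder}) \<Rightarrow> real ^ ('n::{finite,linorder})" where
  "lam_vec A i = (\<chi> k. of_rat (lam A i k))"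

lemma lam_vec_rec:
  "lam_vec A i $ k = (of_int (i $ k) - frac (\<Sum>h\<in>{k<..}. of_int (A $ h $ k) * lam_vec A i $ h))
     / of_int (A $ k $ k)"
  by (simp add: lam_vec_def lam.simps[of A i k] of_rat_divide of_rat_diff of_rat_frac of_rat_sum
      of_rat_mult)

lemma hermite_column_sum:
  fixes A :: "int ^ ('n::{finite,linorder}) ^ ('n::{finite,linorder})" and c :: "real ^ ('n::{finite,linorder})"
  assumes "hermite_normal_form A"
  shows "(\<Sum>h\<in>UNIV. c $ h * of_int (A $ h $ k)) =
    of_int (A $ k $ k) * c $ k + (\<Sum>h\<in>{k<..}. of_int (A $ h $ k) * c $ h)"
proof -
  have "(\<Sum>h\<in>UNIV. c $ h * of_int (A $ h $ k)) = (\<Sum>h\<in>insert k {k<..}. c $ h * of_int (A $ h $ k))"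
    using assms by (intro sum.mono_neutral_right) (auto simp: hermite_normal_form_def not_less)
  then show ?thesis by (simp add: mult.commute)
qed

lemma lam_vec_integral:
  assumes "det A \<noteq> 0" "hermite_normal_form A"
  shows "lam_vec A i \<in> integral_combinations A"
  unfolding integral_combinations_iff
proof
  fix k
  have "A $ k $ k \<noteq> 0" using hermite_diagonal_pos[OF assms, of k] by simp
  then show "(\<Sum>h\<in>UNIV. lam_vec A i $ h * of_int (A $ h $ k)) \<in> \<int>"
    by (simp add: hermite_column_sum[OF assms(2)] lam_vec_rec[of A i k] frac_def)
qed

text \<open>
  The recursion solved for \<open>i\<close>: the index is recovered from \<open>lam_vec\<close>, which gives injectivity,
  and the same formula produces the index of a given representative.
\<close>
lemma lam_vec_index:
  assumes "det A \<noteq> 0" "hermite_normal_form A"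
  shows "of_int (i $ k) = of_int (A $ k $ k) * lam_vec A i $ k +
    frac (\<Sum>h\<in>{k<..}. of_int (A $ h $ k) * lam_vec A i $ h)"
  using hermite_diagonal_pos[OF assms, of k] by (simp add: lam_vec_rec[of A i k])

text \<open>
  The heart of the argument.  For surjectivity, the index \<open>i k\<close> of a given \<open>c\<close> is read off from the
  integrality condition in column \<open>k\<close>; that \<open>lam_vec\<close> then reproduces \<open>c\<close> follows by descending
  induction on the coordinate, as the recursion uses the larger coordinates only.
\<close>
lemma bij_betw_lam_vec:
  fixes A :: "int ^ ('n::{finite,linorder}) ^ ('n::{finite,linorder})"
  assumes "det A \<noteq> 0" "hermite_normal_form A"
  shows "bij_betw (lam_vec A) (index_box A) {c \<in> integral_combinations A. \<forall>k. c $ k \<in> {0<..1}}"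
  unfolding bij_betw_def
proof
  show "inj_on (lam_vec A) (index_box A)"
  proof (rule inj_onI)
    fix i j assume "lam_vec A i = lam_vec A j"
    then have "real_of_int (i $ k) = real_of_int (j $ k)" for k
      using lam_vec_index[OF assms, of i k] lam_vec_index[OF assms, of j k] by simp
    then show "i = j" by (simp add: vec_eq_iff)
  qed
  show "lam_vec A ` index_box A = {c \<in> integral_combinations A. \<forall>k. c $ k \<in> {0<..1}}"
  proof (intro equalityI subsetI)
    fix c assume "c \<in> lam_vec A ` index_box A"
    then show "c \<in> {c \<in> integral_combinations A. \<forall>k. c $ k \<in> {0<..1}}"
      using lam_vec_integral[OF assms] lam_bounds by (auto simp: lam_vec_def)
  next
    fix c assume c: "c \<in> {c \<in> integral_combinations A. \<forall>k. c $ k \<in> {0<..1}}"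
    define S where "S k = (\<Sum>h\<in>{k<..}. of_int (A $ h $ k) * c $ h)" for k
    \<comment> \<open>The floor only converts the number, which is already integral, to type \<open>int\<close>.\<close>
    define i where "i = (\<chi> k. \<lfloor>of_int (A $ k $ k) * c $ k + frac (S k)\<rfloor>)"
    have i: "real_of_int (i $ k) = of_int (A $ k $ k) * c $ k + frac (S k)" for k
    proof -
      have "of_int (A $ k $ k) * c $ k + S k \<in> \<int>"
        using c unfolding S_def hermite_column_sum[OF assms(2), symmetric]
        by (simp add: integral_combinations_iff)
      then have "of_int (A $ k $ k) * c $ k + S k - of_int \<lfloor>S k\<rfloor> \<in> \<int>"
        by (intro Ints_diff) auto
      then show ?thesis by (simp add: i_def frac_def of_int_floor_cancel algebra_simps)
    qed
    have "i \<in> index_box A"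
      unfolding index_box_def
    proof safe
      fix k
      have a: "0 < A $ k $ k" by (rule hermite_diagonal_pos[OF assms])
      have ck: "0 < c $ k" "c $ k \<le> 1" using c by auto
      have "0 < of_int (A $ k $ k) * c $ k" using a ck by simp
      then have "0 < real_of_int (i $ k)" unfolding i using frac_ge_0[of "S k"] by linarith
      then show "1 \<le> i $ k" by simp
      have "of_int (A $ k $ k) * c $ k \<le> of_int (A $ k $ k)" using a ck by simp
      then have "real_of_int (i $ k) < of_int (A $ k $ k) + 1"
        unfolding i using frac_lt_1[of "S k"] by linarith
      then show "i $ k \<le> A $ k $ k" by linarith
    qed
    have "lam_vec A i $ k = c $ k" for k
    proof (induction "card {k<..}" arbitrary: k rule: less_induct)
      case less
      have "lam_vec A i $ h = c $ h" if "k < h" for h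
        using that by (intro less psubset_card_mono) auto
      then have "(\<Sum>h\<in>{k<..}. of_int (A $ h $ k) * lam_vec A i $ h) = S k"
        by (simp add: S_def)
      then show ?case
        using hermite_diagonal_pos[OF assms, of k] by (simp add: lam_vec_rec[of A i k] i)
    qed
    then have "c = lam_vec A i" by (simp add: vec_eq_iff)
    with \<open>i \<in> index_box A\<close> show "c \<in> lam_vec A ` index_box A" by blast
  qed
qed

text \<open>
  The reflection \<open>c \<mapsto> 1 - c\<close> exchanges \<open>(0,1]^d\<close> and \<open>[0,1)^d\<close> and preserves integrality.  This is the
  source of the reciprocity between the exponents \<open>s\<close> and \<open>d + 1 - s\<close>.
\<close>
lemma bij_betw_one_minus_lam_vec:
  fixes A :: "int ^ ('n::{finite,linorder}) ^ ('n::{finite,linorder})"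
  assumes "det A \<noteq> 0" "hermite_normal_form A"
  shows "bij_betw (\<lambda>i. 1 - lam_vec A i) (index_box A)
    {c \<in> integral_combinations A. \<forall>k. c $ k \<in> {0..<1}}"
proof -
  have L: "1 - c \<in> integral_combinations A \<longleftrightarrow> c \<in> integral_combinations A" for c
    using integral_combinations_add_int[of 1 "- c" A] integral_combinations_uminus[of c A]
    by simp
  have "bij_betw (\<lambda>c. 1 - c) {c \<in> integral_combinations A. \<forall>k. c $ k \<in> {0<..1}}
      {c \<in> integral_combinations A. \<forall>k. c $ k \<in> {0..<1}}"
    by (rule bij_betw_byWitness[where f' = "\<lambda>c. 1 - c"]) (auto simp: L)
  from bij_betw_trans[OF bij_betw_lam_vec[OF assms] this] show ?thesis by (simp add: o_def)
qed

section \<open>Generating functions\<close>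

lemma sum_lam_vec: "\<lfloor>\<Sum>k\<in>UNIV. lam_vec A i $ k\<rfloor> = s_exp A i - 1"
proof -
  have "(\<Sum>k\<in>UNIV. lam_vec A i $ k) = of_rat (\<Sum>k\<in>UNIV. lam A i k)"
    by (simp add: lam_vec_def of_rat_sum)
  then show ?thesis by (simp add: s_exp_def)
qed

lemma interior_height:
  fixes A :: "int ^ ('n::{finite,linorder}) ^ ('n::{finite,linorder})"
  assumes "i \<in> index_box A"
  shows "(\<Sum>k\<in>UNIV. (lam_vec A i + (\<chi> k. real (m k))) $ k) < real n \<longleftrightarrow>
    sum m UNIV + nat (s_exp A i) \<le> n"
proof -
  have "(\<Sum>k\<in>UNIV. (lam_vec A i + (\<chi> k. real (m k))) $ k) =
      (\<Sum>k\<in>UNIV. lam_vec A i $ k) + real (sum m UNIV)"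
    by (simp add: sum.distrib)
  then show ?thesis
    using s_exp_bounds[OF assms] sum_lam_vec[of A i] by linarith
qed

lemma closed_height:
  fixes A :: "int ^ ('n::{finite,linorder}) ^ ('n::{finite,linorder})"
  assumes "i \<in> index_box A"
  shows "(\<Sum>k\<in>UNIV. (1 - lam_vec A i + (\<chi> k. real (m k))) $ k) \<le> real n \<longleftrightarrow>
    sum m UNIV + nat (int CARD('n) + 1 - s_exp A i) \<le> n"
proof -
  have "(\<Sum>k\<in>UNIV. (1 - lam_vec A i + (\<chi> k. real (m k))) $ k) =
      real CARD('n) - (\<Sum>k\<in>UNIV. lam_vec A i $ k) + real (sum m UNIV)"
    by (simp add: sum.distrib sum_subtractf)
  then show ?thesis
    using s_exp_bounds[OF assms] sum_lam_vec[of A i] by linarith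
qed

lemma positive_eq_translates: "{0<..} = {t + real m |t m. t \<in> {0<..1}}"
proof (intro equalityI subsetI)
  fix x :: real assume "x \<in> {0<..}"
  then have "x = (x - real (nat (\<lceil>x\<rceil> - 1))) + real (nat (\<lceil>x\<rceil> - 1))
      \<and> x - real (nat (\<lceil>x\<rceil> - 1)) \<in> {0<..1}"
    by auto linarith+
  then show "x \<in> {t + real m |t m. t \<in> {0<..1}}" by blast
qed auto

lemma nonnegative_eq_translates: "{0..} = {t + real m |t m. t \<in> {0..<1}}"
proof (intro equalityI subsetI)
  fix x :: real assume "x \<in> {0..}"
  then have "x = (x - real (nat \<lfloor>x\<rfloor>)) + real (nat \<lfloor>x\<rfloor>) \<and> x - real (nat \<lfloor>x\<rfloor>) \<in> {0..<1}"
    by auto linarith+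
  then show "x \<in> {t + real m |t m. t \<in> {0..<1}}" by blast
qed auto

lemma interior_lattice_count_nth:
  fixes A :: "int ^ ('n::{finite,linorder}) ^ ('n::{finite,linorder})"
  assumes "det A \<noteq> 0" "hermite_normal_form A" "n > 0"
  shows "of_nat (interior_lattice_count (row_simplex A) n) =
    fps_nth (inverse ((1 - fps_X) ^ (CARD('n) + 1)) *
      (\<Sum>i\<in>index_box A. fps_X ^ nat (s_exp A i)) :: rat fps) n"
  unfolding interior_lattice_count_eq[OF assms(1,3)]
  by (intro card_tiling[OF bij_betw_tiling[OF bij_betw_lam_vec[OF assms(1,2)] _ _
        positive_eq_translates] finite_index_box interior_height])
     (simp_all add: half_open_interval_def integral_combinations_add_int)

lemma lattice_count_nth:
  fixes A :: "int ^ ('n::{finite,linorder}) ^ ('n::{finite,linorder})"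
  assumes "det A \<noteq> 0" "hermite_normal_form A"
  shows "of_nat (lattice_count (row_simplex A) n) =
    fps_nth (inverse ((1 - fps_X) ^ (CARD('n) + 1)) *
      (\<Sum>i\<in>index_box A. fps_X ^ nat (int CARD('n) + 1 - s_exp A i)) :: rat fps) n"
  unfolding lattice_count_eq[OF assms(1)]
  by (intro card_tiling[OF bij_betw_tiling[OF bij_betw_one_minus_lam_vec[OF assms] _ _
        nonnegative_eq_translates] finite_index_box closed_height])
     (simp_all add: half_open_interval_def integral_combinations_add_int)

lemma lattice_count_0: "lattice_count (row_simplex A) 0 = 1"
proof -
  have "0 \<in> row_simplex A" unfolding row_simplex_def by (intro hull_inc) simp
  then have "(\<lambda>x. real 0 *\<^sub>R x) ` row_simplex A \<inter> lattice_points = {0}"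
    by (auto simp: lattice_points_def)
  then show ?thesis by (simp add: lattice_count_def)
qed

theorem theorem2p1:
  fixes A :: "int ^ ('n::{finite,linorder}) ^ ('n::{finite,linorder})"
  assumes "det A \<noteq> 0" and "hermite_normal_form A"
  shows "(Abs_fps (\<lambda>n. if n = 0 then 0 else of_nat (interior_lattice_count (row_simplex A) n))
            :: rat fps) =
           inverse ((1 - fps_X) ^ (CARD('n) + 1)) *
             (\<Sum>i\<in>index_box A. fps_X ^ nat (s_exp A i))
       \<and> delta_series (row_simplex A) =
           fps_of_poly (\<Sum>i\<in>index_box A. monom 1 (nat (int CARD('n) + 1 - s_exp A i)))"
proof
  let ?D = "(1 - fps_X) ^ (CARD('n) + 1) :: rat fps"
  let ?N = "\<Sum>i\<in>index_box A. fps_X ^ nat (s_exp A i) :: rat fps"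
  \<comment> \<open>All exponents are at least 1, so the right-hand side has the constant term 0 as well.\<close>
  have "fps_nth ?N 0 = 0"
    using s_exp_bounds(1)[of _ A] by (force simp: fps_sum_nth intro!: sum.neutral)
  then show "Abs_fps (\<lambda>n. if n = 0 then 0 else of_nat (interior_lattice_count (row_simplex A) n)) =
      inverse ?D * ?N"
    by (intro fps_ext) (simp add: interior_lattice_count_nth[OF assms] del: power_Suc)
  \<comment> \<open>The separate summand 1 in the definition is the number of lattice points of the dilate by 0.\<close>
  let ?E = "\<Sum>i\<in>index_box A. fps_X ^ nat (int CARD('n) + 1 - s_exp A i) :: rat fps"
  have "1 + Abs_fps (\<lambda>n. if n = 0 then 0 else of_nat (lattice_count (row_simplex A) n)) =
      Abs_fps (\<lambda>n. of_nat (lattice_count (row_simplex A) n))"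
    by (intro fps_ext) (simp add: lattice_count_0)
  also have "\<dots> = inverse ?D * ?E"
    by (intro fps_ext) (simp only: fps_nth_Abs_fps lattice_count_nth[OF assms])
  finally have "delta_series (row_simplex A) = ?D * (inverse ?D * ?E)"
    unfolding delta_series_def by (rule arg_cong)
  also have "?D * inverse ?D = 1" by (rule inverse_mult_eq_1') simp
  then have "?D * (inverse ?D * ?E) = ?E" by (simp only: mult.assoc[symmetric] mult_1_left)
  also have "?E = fps_of_poly (\<Sum>i\<in>index_box A. monom 1 (nat (int CARD('n) + 1 - s_exp A i)))"
    by (simp add: fps_of_poly_sum fps_of_poly_monom)
  finally show "delta_series (row_simplex A) =
      fps_of_poly (\<Sum>i\<in>index_box A. monom 1 (nat (int CARD('n) + 1 - s_exp A i)))" .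
qed

end
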